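(* Let $V\in\mathbb{R}^{n\times n}$ be a nonsingular covariance matrix (symmetric positive definite), $\eta=\operatorname{diag}(V)$, and let $\sqrt\eta$ be the entrywise square root of $\eta$. For $\sigma>0$ let $$S_\sigma^+:=\{\mathbf w\in\mathbb{R}^n:\ \mathbf 1_n^\top\mathbf w=1,\ \mathbf w^\top V\mathbf w=\sigma^2,\ \mathbf w\ge0\},$$ and let $$d_{\max}:=\max\Big\{\tfrac12\mathbf w^\top D_\eta\mathbf w:\ \mathbf w\ge0,\ \mathbf 1_n^\top\mathbf w=1\Big\},\qquad D_\eta:=\tfrac12(\eta\mathbf 1_n^\top+\mathbf 1_n\eta^\top)-\sqrt\eta\sqrt\eta^\top .$$ Then, for every $\sigma$ with $S_\sigma^+\neq\emptyset$, $$\max_{\mathbf w\in S_\sigma^+}\mathbf w^\top\sqrt\eta\sqrt\eta^\top\mathbf w\ \le\ \max_{\mathbf w\in S_\sigma^+}\eta^\top\mathbf w\ \le\ \max_{\mathbf w\in S_\sigma^+}\mathbf w^\top\sqrt\eta\sqrt\eta^\top\mathbf w+2\,d_{\max} .$$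
   Context: $\mathbf 1_n\in\mathbb{R}^n$ is the all-ones column vector, $\operatorname{diag}(V)$ is the column vector of diagonal entries of $V$, and $\mathbf w\ge0$ is meant entrywise. Maximizing $\eta^\top\mathbf w$ at fixed risk $\mathbf w^\top V\mathbf w=\sigma^2$ corresponds to the maximum diversification return portfolio, and maximizing $\mathbf w^\top\sqrt\eta\sqrt\eta^\top\mathbf w$ at fixed risk corresponds to the maximum diversification ratio portfolio. *)

theory Defs
  imports "HOL-Analysis.Analysis"
begin

definition symmetric_pos_def :: "real^'n^'n \<Rightarrow> bool" where
  "symmetric_pos_def V \<longleftrightarrow> transpose V = V \<and> (\<forall>x. x \<noteq> 0 \<longrightarrow> x \<bullet> (V *v x) > 0)"

definition diag_vec :: "real^'n^'n \<Rightarrow> real^'n" where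
  "diag_vec V = (\<chi> i. V $ i $ i)"

definition sqrt_vec :: "real^'n \<Rightarrow> real^'n" where
  "sqrt_vec v = (\<chi> i. sqrt (v $ i))"

definition outer :: "real^'n \<Rightarrow> real^'n \<Rightarrow> real^'n^'n" where
  "outer u v = (columnvector u :: real^1^'n) ** rowvector v"

(* The numeral 1 at type real^'n is the all-ones vector, so 1 \<bullet> w is the sum of the entries of w. *)
definition long_only :: "(real^'n) set" where
  "long_only = {w. (\<forall>i. w $ i \<ge> 0) \<and> 1 \<bullet> w = 1}"

definition S_plus :: "real^'n^'n \<Rightarrow> real \<Rightarrow> (real^'n) set" where
  "S_plus V \<sigma> = {w. 1 \<bullet> w = 1 \<and> w \<bullet> (V *v w) = \<sigma>\<^sup>2 \<and> (\<forall>i. w $ i \<ge> 0)}"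

definition D_mat :: "real^'n \<Rightarrow> real^'n^'n" where
  "D_mat \<eta> = (1/2) *\<^sub>R (outer \<eta> 1 + outer 1 \<eta>) - outer (sqrt_vec \<eta>) (sqrt_vec \<eta>)"

(* max_val is the maximum only if it is attained; otherwise its value is unspecified. *)
definition attains_max :: "('a \<Rightarrow> real) \<Rightarrow> 'a set \<Rightarrow> bool" where
  "attains_max f S \<longleftrightarrow> (\<exists>w\<in>S. \<forall>v\<in>S. f v \<le> f w)"

definition max_val :: "('a \<Rightarrow> real) \<Rightarrow> 'a set \<Rightarrow> real" where
  "max_val f S = (GREATEST y. y \<in> f ` S)"

definition diversification_ratio_obj :: "real^'n \<Rightarrow> real^'n \<Rightarrow> real" where
  "diversification_ratio_obj \<eta> w = w \<bullet> (outer (sqrt_vec \<eta>) (sqrt_vec \<eta>) *v w)"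

definition half_D_form :: "real^'n \<Rightarrow> real^'n \<Rightarrow> real" where
  "half_D_form \<eta> w = 1/2 * (w \<bullet> (D_mat \<eta> *v w))"

definition d_max :: "real^'n \<Rightarrow> real" where
  "d_max \<eta> = max_val (half_D_form \<eta>) long_only"

end

(* On the simplex the quadratic form of D_mat is the gap between the two objectives:
   w \<bullet> (D_mat \<eta> *v w) = \<eta> \<bullet> w - (sqrt_vec \<eta> \<bullet> w)^2, which is nonnegative as the variance of the
   entries of sqrt_vec \<eta> under the weights w, and is at most 2 * d_max \<eta>. *)
theory Submission imports Defs begin

lemma outer_mult_vec: "outer u v *v w = (v \<bullet> w) *\<^sub>R u"
  by (simp add: outer_def columnvector_def rowvector_def matrix_matrix_mult_def
      matrix_vector_mult_def inner_vec_def vec_eq_iff sum_distrib_left mult_ac)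

lemma one_inner_vec: "(1 :: real^'n) \<bullet> w = (\<Sum>i\<in>UNIV. w $ i)"
  by (simp add: inner_vec_def)

lemma diversification_ratio_obj_eq:
  "diversification_ratio_obj \<eta> w = (sqrt_vec \<eta> \<bullet> w)\<^sup>2"
  by (simp add: diversification_ratio_obj_def outer_mult_vec power2_eq_square inner_commute)

text \<open>In the quadratic form at \<open>w\<close>, each of the two outer products with
  \<open>1\<close> contributes (\<eta> \<bullet> w)(1 \<bullet> w), so the budget constraint turns
  their average into \<eta> \<bullet> w. The factor 2 cancels the 1/2 in
  \<open>half_D_form\<close>.\<close>

lemma half_D_form_eq:
  assumes "1 \<bullet> w = 1"
  shows "2 * half_D_form \<eta> w = \<eta> \<bullet> w - diversification_ratio_obj \<eta> w"
  using assms
  by (simp add: half_D_form_def D_mat_def diversification_ratio_obj_def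
      matrix_vector_mult_diff_rdistrib matrix_vector_mult_add_rdistrib
      scaleR_matrix_vector_assoc[symmetric] outer_mult_vec inner_diff_right inner_add_right
      inner_commute[of w])

lemma diversification_ratio_obj_le:
  fixes \<eta> :: "real^'n"
  assumes "\<And>i. 0 \<le> \<eta> $ i" and w: "w \<in> long_only"
  shows "diversification_ratio_obj \<eta> w \<le> \<eta> \<bullet> w"
proof -
  define m where "m = sqrt_vec \<eta> \<bullet> w"
  have m: "m = (\<Sum>i\<in>UNIV. sqrt (\<eta> $ i) * w $ i)"
    by (simp add: m_def inner_vec_def sqrt_vec_def)
  \<comment> \<open>The variance about the weighted mean \<open>m\<close>; its expansion replaces
    the square of \<open>sqrt (\<eta> $ i)\<close> by \<open>\<eta> $ i\<close>, which is where the
    sign of \<eta> enters.\<close>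
  have "0 \<le> (\<Sum>i\<in>UNIV. w $ i * (sqrt (\<eta> $ i) - m)\<^sup>2)"
    using w by (intro sum_nonneg) (simp add: long_only_def)
  also have "\<dots> = (\<Sum>i\<in>UNIV. \<eta> $ i * w $ i - 2 * m * (sqrt (\<eta> $ i) * w $ i) + m\<^sup>2 * w $ i)"
    using assms(1) by (intro sum.cong) (simp_all add: power2_diff algebra_simps)
  also have "\<dots> = \<eta> \<bullet> w - 2 * m * m + m\<^sup>2 * (1 \<bullet> w)"
    by (simp add: sum.distrib sum_subtractf sum_distrib_left[symmetric] m one_inner_vec inner_vec_def)
  \<comment> \<open>Total weight one leaves \<eta> \<bullet> w minus the square of
    \<open>m\<close>.\<close>
  also have "1 \<bullet> w = 1"
    using w by (simp add: long_only_def)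
  finally show ?thesis
    by (simp add: diversification_ratio_obj_eq m_def[symmetric] power2_eq_square)
qed

lemma compact_long_only: "compact (long_only :: (real^'n) set)"
proof -
  \<comment> \<open>The Euclidean norm is at most the l1 norm, which for nonnegative entries is
    their sum.\<close>
  have "norm w \<le> 1" if "w \<in> long_only" for w :: "real^'n"
    using norm_le_l1_cart[of w] that by (simp add: long_only_def one_inner_vec)
  then have "bounded (long_only :: (real^'n) set)"
    unfolding bounded_iff by blast
  moreover have "closed (long_only :: (real^'n) set)"
    unfolding long_only_def
    by (intro closed_Collect_conj closed_Collect_all closed_Collect_le closed_Collect_eq
        continuous_intros)
  ultimately show ?thesis
    by (simp add: compact_eq_bounded_closed)
qed

text \<open>Exhibits the feasible set as a closed slice of the simplex, so that it inherits
  compactness.\<close>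

lemma S_plus_eq: "S_plus V \<sigma> = long_only \<inter> {w. w \<bullet> (V *v w) = \<sigma>\<^sup>2}"
  by (auto simp: S_plus_def long_only_def)

lemma compact_S_plus: "compact (S_plus V \<sigma>)"
  unfolding S_plus_eq
  by (intro compact_Int_closed compact_long_only closed_Collect_eq continuous_intros
      matrix_vector_mult_linear_continuous_on)

lemma compact_attains_max:
  assumes "compact S" "S \<noteq> {}" "continuous_on S f"
  shows "attains_max f S"
  using continuous_attains_sup[OF assms] by (auto simp: attains_max_def)

text \<open>A maximizer pins down the \<open>GREATEST\<close> in \<open>max_val\<close>; every later
  bound on \<open>max_val\<close> passes through such a witness.\<close>

lemma max_val_eq:
  assumes "w \<in> S" "\<And>v. v \<in> S \<Longrightarrow> f v \<le> f w"
  shows "max_val f S = f w"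
  unfolding max_val_def by (rule Greatest_equality) (use assms in auto)

lemma max_val_ge:
  assumes "attains_max f S" "v \<in> S"
  shows "f v \<le> max_val f S"
  using assms max_val_eq[of _ S f] unfolding attains_max_def by metis

lemma max_val_le:
  assumes "attains_max f S" "\<And>v. v \<in> S \<Longrightarrow> f v \<le> c"
  shows "max_val f S \<le> c"
  using assms max_val_eq[of _ S f] unfolding attains_max_def by metis

theorem mainTheorem7:
  fixes V :: "real^'n^'n" and \<eta> :: "real^'n" and \<sigma> :: real
  assumes "symmetric_pos_def V"
    and "\<eta> = diag_vec V"
    and "\<sigma> > 0"
    and "S_plus V \<sigma> \<noteq> {}"
  shows "attains_max (half_D_form \<eta>) long_only
    \<and> attains_max (diversification_ratio_obj \<eta>) (S_plus V \<sigma>)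
    \<and> attains_max (\<lambda>w. \<eta> \<bullet> w) (S_plus V \<sigma>)
    \<and> max_val (diversification_ratio_obj \<eta>) (S_plus V \<sigma>) \<le> max_val (\<lambda>w. \<eta> \<bullet> w) (S_plus V \<sigma>)
    \<and> max_val (\<lambda>w. \<eta> \<bullet> w) (S_plus V \<sigma>)
        \<le> max_val (diversification_ratio_obj \<eta>) (S_plus V \<sigma>) + 2 * d_max \<eta>"
proof -
  have sub: "w \<in> long_only" "1 \<bullet> w = 1" if "w \<in> S_plus V \<sigma>" for w
    using that by (auto simp: S_plus_eq long_only_def)
  have \<eta>_nonneg: "0 \<le> \<eta> $ i" for i
  proof -
    \<comment> \<open>The quadratic form of \<open>V\<close> at a standard basis vector is the
      diagonal entry.\<close>
    have "0 < axis i 1 \<bullet> (V *v axis i 1)"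
      using assms(1) by (simp add: symmetric_pos_def_def axis_eq_0_iff)
    then show ?thesis
      by (simp add: assms(2) diag_vec_def inner_axis' matrix_vector_mult_basis column_def)
  qed
  \<comment> \<open>The simplex is nonempty because it contains the nonempty set
    \<open>S_plus V \<sigma>\<close>.\<close>
  have A: "attains_max (half_D_form \<eta>) long_only"
    unfolding half_D_form_def using assms(4) sub
    by (intro compact_attains_max compact_long_only continuous_intros
        matrix_vector_mult_linear_continuous_on) auto
  have B: "attains_max (diversification_ratio_obj \<eta>) (S_plus V \<sigma>)"
    unfolding diversification_ratio_obj_def
    by (intro compact_attains_max compact_S_plus assms(4) continuous_intros
        matrix_vector_mult_linear_continuous_on)
  have C: "attains_max (\<lambda>w. \<eta> \<bullet> w) (S_plus V \<sigma>)"
    by (intro compact_attains_max compact_S_plus assms(4) continuous_intros)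
  have "max_val (diversification_ratio_obj \<eta>) (S_plus V \<sigma>) \<le> max_val (\<lambda>w. \<eta> \<bullet> w) (S_plus V \<sigma>)"
  proof (rule max_val_le[OF B])
    fix w assume w: "w \<in> S_plus V \<sigma>"
    show "diversification_ratio_obj \<eta> w \<le> max_val (\<lambda>w. \<eta> \<bullet> w) (S_plus V \<sigma>)"
      using diversification_ratio_obj_le[OF \<eta>_nonneg sub(1)[OF w]] max_val_ge[OF C w]
      by (rule order_trans)
  qed
  moreover have "max_val (\<lambda>w. \<eta> \<bullet> w) (S_plus V \<sigma>)
      \<le> max_val (diversification_ratio_obj \<eta>) (S_plus V \<sigma>) + 2 * d_max \<eta>"
  proof (rule max_val_le[OF C])
    fix w assume w: "w \<in> S_plus V \<sigma>"
    \<comment> \<open>Here \<eta> \<bullet> w splits into the ratio objective and twice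
      \<open>half_D_form\<close>, both at \<open>w\<close>. Each is bounded by its own maximum, the
      second over the whole simplex.\<close>
    show "\<eta> \<bullet> w \<le> max_val (diversification_ratio_obj \<eta>) (S_plus V \<sigma>) + 2 * d_max \<eta>"
      using half_D_form_eq[OF sub(2)[OF w], of \<eta>] max_val_ge[OF B w] max_val_ge[OF A sub(1)[OF w]]
      by (simp add: d_max_def)
  qed
  ultimately show ?thesis
    using A B C by blast
qed

end
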